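(* Let $P_1,\dots,P_n$ be discrete probability measures on $\mathbb{R}^d$, at least one of which satisfies $|P_i|\ge2$, and let $\lambda\in\mathbb{R}^n$ be a strictly positive weight vector with $\sum_{i=1}^n\lambda_i=1$. Then LP (reduced) has strictly fewer variables than LP (original). Further, the nonzero entries of the constraint matrix for LP (reduced) are a strict subset of the nonzero entries in the corresponding columns of the constraint matrix of LP (original).
   Context: Discrete measures: each $P_i$ is a probability measure on $\mathbb{R}^d$ with finite support $\mathrm{supp}(P_i)=\{\mathbf{x}_{ij} : j=1,\dots,|P_i|\}$ (distinct points; $|P_i|$ denotes the number of support points), with mass $d_{ij}>0$ at $\mathbf{x}_{ij}$ and $\sum_{j=1}^{|P_i|}d_{ij}=1$. Set of weighted means: $S=\{\sum_{i=1}^n\lambda_i\mathbf{x}_{ij_i} : 1\le j_i\le|P_i|\text{ for all }i\}=\{\mathbf{x}_1,\dots,\mathbf{x}_{|S|}\}$ (distinct elements). Index sets: $S_{ij}$ is the set of indices $k$ such that $\mathbf{x}_k=\lambda_i\mathbf{x}_{ij}+\sum_{l\ne i}\lambda_l\mathbf{x}_{lj_l}$ for some choice of $\mathbf{x}_{lj_l}\in\mathrm{supp}(P_l)$, $l\ne i$. $S_k$ is the set of pairs $(i,j)$ with $k\in S_{ij}$. LP (original), in variables $y_{ijk}$ ($i\le n$, $j\le|P_i|$, $k\le|S|$) and $z_k$ ($k\le|S|$): minimize $\sum_{i=1}^n\lambda_i\sum_{j=1}^{|P_i|}\sum_{k=1}^{|S|}\|\mathbf{x}_k-\mathbf{x}_{ij}\|^2y_{ijk}$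 subject to $\sum_{j=1}^{|P_i|}y_{ijk}=z_k$ for all $i\le n$, $k\le|S|$; $\sum_{k=1}^{|S|}y_{ijk}=d_{ij}$ for all $i\le n$, $j\le|P_i|$; $y_{ijk}\ge0$ for all $i,j,k$. LP (reduced), in variables $y_{ijk}$ ($i\le n$, $j\le|P_i|$, $k\in S_{ij}$) and $z_k$ ($k\le|S|$): minimize $\sum_{i=1}^n\lambda_i\sum_{j=1}^{|P_i|}\sum_{k\in S_{ij}}\|\mathbf{x}_k-\mathbf{x}_{ij}\|^2y_{ijk}$ subject to $\sum_{j:(i,j)\in S_k}y_{ijk}=z_k$ for all $i\le n$, $k\le|S|$; $\sum_{k\in S_{ij}}y_{ijk}=d_{ij}$ for all $i\le n$, $j\le|P_i|$; $y_{ijk}\ge0$ for all $i\le n$, $j\le|P_i|$, $k\in S_{ij}$. The constraint matrix of each LP is the coefficient matrix of its equality constraints; its columns are indexed by the variables, and columns of the two matrices correspond when they belong to variables of the same name.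
   Formalization: In corresponding columns the nonzero entries of the two matrices coincide, so the strict inclusion is taken in the set of all nonzero entries of the constraint matrix of LP (original); each entry of LP (reduced) still lies in its corresponding column, with the same row and value. *)

theory Defs
  imports "HOL-Analysis.Analysis" "HOL-Probability.Probability_Mass_Function"
begin

text \<open>
  All index ranges start at 1. A discrete measure is a \<open>pmf\<close> with finite support; \<open>x i\<close> enumerates
  the support of \<open>P i\<close> along \<open>{1..supp_size P i}\<close>, and \<open>xs\<close> enumerates the set of weighted means
  along \<open>{1..card S}\<close>. That these are enumerations without repetition (\<open>bij_betw\<close>) is not
  built into the definitions; it has to be assumed where they are used.
\<close>

definition supp_size :: "(nat \<Rightarrow> 'a pmf) \<Rightarrow> nat \<Rightarrow> nat" where
  "supp_size P i = card (set_pmf (P i))"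

definition weighted_means ::
  "nat \<Rightarrow> (nat \<Rightarrow> (real^'d) pmf) \<Rightarrow> (nat \<Rightarrow> real) \<Rightarrow> (nat \<Rightarrow> nat \<Rightarrow> real^'d) \<Rightarrow> (real^'d) set" where
  "weighted_means n P lam x =
     {\<Sum>i\<in>{1..n}. lam i *\<^sub>R x i (j i) | j. \<forall>i\<in>{1..n}. j i \<in> {1..supp_size P i}}"

text \<open>The set \<open>S\<^sub>i\<^sub>j\<close> of indices \<open>k\<close>.\<close>

definition mean_indices ::
  "nat \<Rightarrow> (nat \<Rightarrow> (real^'d) pmf) \<Rightarrow> (nat \<Rightarrow> real) \<Rightarrow> (nat \<Rightarrow> nat \<Rightarrow> real^'d) \<Rightarrow> (nat \<Rightarrow> real^'d) \<Rightarrow>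
   nat \<Rightarrow> nat \<Rightarrow> nat set" where
  "mean_indices n P lam x xs i j =
     {k \<in> {1..card (weighted_means n P lam x)}.
        \<exists>m. (\<forall>l\<in>{1..n} - {i}. m l \<in> {1..supp_size P l}) \<and>
            xs k = lam i *\<^sub>R x i j + (\<Sum>l\<in>{1..n} - {i}. lam l *\<^sub>R x l (m l))}"

text \<open>The set \<open>S\<^sub>k\<close> of pairs \<open>(i, j)\<close>.\<close>

definition mean_pairs ::
  "nat \<Rightarrow> (nat \<Rightarrow> (real^'d) pmf) \<Rightarrow> (nat \<Rightarrow> real) \<Rightarrow> (nat \<Rightarrow> nat \<Rightarrow> real^'d) \<Rightarrow> (nat \<Rightarrow> real^'d) \<Rightarrow>
   nat \<Rightarrow> (nat \<times> nat) set" where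
  "mean_pairs n P lam x xs k =
     {(i, j). i \<in> {1..n} \<and> j \<in> {1..supp_size P i} \<and> k \<in> mean_indices n P lam x xs i j}"

text \<open>
  A linear program (minimization) with variables named by \<open>'v\<close> and equality constraints named
  by \<open>'c\<close>: constraint \<open>r\<close> reads \<open>lp_lhs r v = lp_rhs r\<close>, where all terms containing variables have been
  moved to the left. The variables in \<open>lp_nonneg\<close> are sign-constrained, the others are free.
\<close>

record ('v, 'c) lin_prog =
  lp_vars :: "'v set"
  lp_objective :: "('v \<Rightarrow> real) \<Rightarrow> real"
  lp_rows :: "'c set"
  lp_lhs :: "'c \<Rightarrow> ('v \<Rightarrow> real) \<Rightarrow> real"
  lp_rhs :: "'c \<Rightarrow> real"
  lp_nonneg :: "'v set"

text \<open>
  The coefficient of variable \<open>c\<close> in the linear form \<open>lp_lhs L r\<close> is its value at the unit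
  assignment of \<open>c\<close>. This is meaningful for \<open>r \<in> lp_rows L\<close> and \<open>c \<in> lp_vars L\<close> only.
\<close>

definition constraint_matrix :: "('v, 'c) lin_prog \<Rightarrow> 'c \<Rightarrow> 'v \<Rightarrow> real" where
  "constraint_matrix L r c = lp_lhs L r (\<lambda>v. if v = c then 1 else 0)"

text \<open>
  A nonzero entry is recorded with its row, its column and its value. Since columns are named by
  variables, columns of two programs over the same type of names correspond when the names agree.
\<close>

definition nonzero_entries :: "('v, 'c) lin_prog \<Rightarrow> ('c \<times> 'v \<times> real) set" where
  "nonzero_entries L =
     {(r, c, a). r \<in> lp_rows L \<and> c \<in> lp_vars L \<and> a = constraint_matrix L r c \<and> a \<noteq> 0}"

text \<open>\<open>Y i j k\<close> stands for \<open>y\<^sub>i\<^sub>j\<^sub>k\<close> and \<open>Z k\<close> for \<open>z\<^sub>k\<close>.\<close>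

datatype bary_var = Y nat nat nat | Z nat

text \<open>
  \<open>Link i k\<close> names the constraint equating a sum over \<open>j\<close> with \<open>z\<^sub>k\<close>, and \<open>Mass i j\<close> the constraint
  with right-hand side \<open>d\<^sub>i\<^sub>j\<close>, which is \<open>pmf (P i) (x i j)\<close>. Both programs have the same constraint names.
\<close>

datatype bary_row = Link nat nat | Mass nat nat

definition bary_rows :: "nat \<Rightarrow> (nat \<Rightarrow> 'a pmf) \<Rightarrow> nat \<Rightarrow> bary_row set" where
  "bary_rows n P s =
     {Link i k | i k. i \<in> {1..n} \<and> k \<in> {1..s}} \<union>
     {Mass i j | i j. i \<in> {1..n} \<and> j \<in> {1..supp_size P i}}"

definition lp_original ::
  "nat \<Rightarrow> (nat \<Rightarrow> (real^'d) pmf) \<Rightarrow> (nat \<Rightarrow> real) \<Rightarrow> (nat \<Rightarrow> nat \<Rightarrow> real^'d) \<Rightarrow> (nat \<Rightarrow> real^'d) \<Rightarrow>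
   (bary_var, bary_row) lin_prog" where
  "lp_original n P lam x xs =
     (let s = card (weighted_means n P lam x);
          ys = {Y i j k | i j k. i \<in> {1..n} \<and> j \<in> {1..supp_size P i} \<and> k \<in> {1..s}}
      in \<lparr> lp_vars = ys \<union> {Z k | k. k \<in> {1..s}},
           lp_objective = (\<lambda>v. \<Sum>i\<in>{1..n}. lam i *
              (\<Sum>j\<in>{1..supp_size P i}. \<Sum>k\<in>{1..s}. (norm (xs k - x i j))\<^sup>2 * v (Y i j k))),
           lp_rows = bary_rows n P s,
           lp_lhs = (\<lambda>r v. case r of
              Link i k \<Rightarrow> (\<Sum>j\<in>{1..supp_size P i}. v (Y i j k)) - v (Z k)
            | Mass i j \<Rightarrow> (\<Sum>k\<in>{1..s}. v (Y i j k))),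
           lp_rhs = (\<lambda>r. case r of Link i k \<Rightarrow> 0 | Mass i j \<Rightarrow> pmf (P i) (x i j)),
           lp_nonneg = ys \<rparr>)"

definition lp_reduced ::
  "nat \<Rightarrow> (nat \<Rightarrow> (real^'d) pmf) \<Rightarrow> (nat \<Rightarrow> real) \<Rightarrow> (nat \<Rightarrow> nat \<Rightarrow> real^'d) \<Rightarrow> (nat \<Rightarrow> real^'d) \<Rightarrow>
   (bary_var, bary_row) lin_prog" where
  "lp_reduced n P lam x xs =
     (let s = card (weighted_means n P lam x);
          Sij = mean_indices n P lam x xs;
          Sk = mean_pairs n P lam x xs;
          ys = {Y i j k | i j k. i \<in> {1..n} \<and> j \<in> {1..supp_size P i} \<and> k \<in> Sij i j}
      in \<lparr> lp_vars = ys \<union> {Z k | k. k \<in> {1..s}},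
           lp_objective = (\<lambda>v. \<Sum>i\<in>{1..n}. lam i *
              (\<Sum>j\<in>{1..supp_size P i}. \<Sum>k\<in>Sij i j. (norm (xs k - x i j))\<^sup>2 * v (Y i j k))),
           lp_rows = bary_rows n P s,
           lp_lhs = (\<lambda>r v. case r of
              Link i k \<Rightarrow> (\<Sum>j | (i, j) \<in> Sk k. v (Y i j k)) - v (Z k)
            | Mass i j \<Rightarrow> (\<Sum>k\<in>Sij i j. v (Y i j k))),
           lp_rhs = (\<lambda>r. case r of Link i k \<Rightarrow> 0 | Mass i j \<Rightarrow> pmf (P i) (x i j)),
           lp_nonneg = ys \<rparr>)"

lemma finite_lp_vars:
  "finite (lp_vars (lp_original n P lam x xs))" "finite (lp_vars (lp_reduced n P lam x xs))"
proof -
  let ?K = "{1..card (weighted_means n P lam x)}"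
  let ?B = "(\<Union>i\<in>{1..n}. \<Union>j\<in>{1..supp_size P i}. Y i j ` ?K) \<union> Z ` ?K"
  have "finite ?B" by simp
  moreover have "lp_vars (lp_original n P lam x xs) \<subseteq> ?B"
    unfolding lp_original_def Let_def lin_prog.simps by blast
  moreover have "lp_vars (lp_reduced n P lam x xs) \<subseteq> ?B"
    unfolding lp_reduced_def Let_def lin_prog.simps mean_indices_def by blast
  ultimately show "finite (lp_vars (lp_original n P lam x xs))"
    "finite (lp_vars (lp_reduced n P lam x xs))"
    using finite_subset by blast+
qed

lemma sum_unit_assignment:
  assumes "finite V" "\<And>a. a \<in> A \<Longrightarrow> h a \<in> V"
  shows "(\<Sum>c\<in>V. (\<Sum>a\<in>A. if h a = c then 1 else 0) * v c) = (\<Sum>a\<in>A. v (h a) :: real)"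
proof -
  have "(\<Sum>c\<in>V. (\<Sum>a\<in>A. if h a = c then 1 else 0) * v c)
        = (\<Sum>a\<in>A. \<Sum>c\<in>V. (if h a = c then 1 else 0) * v c)"
    by (simp only: sum_distrib_right) (rule sum.swap)
  also have "\<dots> = (\<Sum>a\<in>A. v (h a))"
  proof (rule sum.cong[OF refl])
    fix a assume "a \<in> A"
    have "(\<Sum>c\<in>V. (if h a = c then 1 else 0) * v c) = (\<Sum>c\<in>V. if h a = c then v c else 0)"
      by (rule sum.cong) auto
    then show "(\<Sum>c\<in>V. (if h a = c then 1 else 0) * v c) = v (h a)"
      using assms \<open>a \<in> A\<close> by simp
  qed
  finally show ?thesis .
qed

lemma sum_unit_assignment_single:
  assumes "finite V" "b \<in> V"
  shows "(\<Sum>c\<in>V. (if b = c then 1 else 0) * v c) = (v b :: real)"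
  using sum_unit_assignment[of V "{()}" "\<lambda>_. b" v] assms by simp

text \<open>In both programs the constraint matrix represents the left-hand sides of the constraints.\<close>

lemma constraint_matrix_original:
  assumes "r \<in> lp_rows (lp_original n P lam x xs)"
  shows "lp_lhs (lp_original n P lam x xs) r v =
    (\<Sum>c\<in>lp_vars (lp_original n P lam x xs). constraint_matrix (lp_original n P lam x xs) r c * v c)"
proof (cases r)
  case (Link i k)
  let ?V = "lp_vars (lp_original n P lam x xs)"
  have "Z k \<in> ?V" "\<And>j. j \<in> {1..supp_size P i} \<Longrightarrow> Y i j k \<in> ?V"
    using assms Link by (auto simp: lp_original_def Let_def bary_rows_def)
  then have
    "(\<Sum>c\<in>?V. (\<Sum>j\<in>{1..supp_size P i}. if Y i j k = c then 1 else 0) * v c)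
       = (\<Sum>j\<in>{1..supp_size P i}. v (Y i j k))"
    "(\<Sum>c\<in>?V. (if Z k = c then 1 else 0) * v c) = v (Z k)"
    by (auto intro!: sum_unit_assignment sum_unit_assignment_single finite_lp_vars)
  moreover have "constraint_matrix (lp_original n P lam x xs) r c =
      (\<Sum>j\<in>{1..supp_size P i}. if Y i j k = c then 1 else 0) - (if Z k = c then 1 else 0)" for c
    by (simp add: Link constraint_matrix_def lp_original_def Let_def)
  moreover have "lp_lhs (lp_original n P lam x xs) r v =
      (\<Sum>j\<in>{1..supp_size P i}. v (Y i j k)) - v (Z k)"
    by (simp add: Link lp_original_def Let_def)
  ultimately show ?thesis by (simp only: left_diff_distrib sum_subtractf)
next
  case (Mass i j)
  let ?V = "lp_vars (lp_original n P lam x xs)"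
  let ?A = "{1..card (weighted_means n P lam x)}"
  have "\<And>k. k \<in> ?A \<Longrightarrow> Y i j k \<in> ?V"
    using assms Mass by (auto simp: lp_original_def Let_def bary_rows_def)
  then have "(\<Sum>c\<in>?V. (\<Sum>k\<in>?A. if Y i j k = c then 1 else 0) * v c) = (\<Sum>k\<in>?A. v (Y i j k))"
    by (auto intro!: sum_unit_assignment finite_lp_vars)
  moreover have "constraint_matrix (lp_original n P lam x xs) r c =
      (\<Sum>k\<in>?A. if Y i j k = c then 1 else 0)" for c
    by (simp add: Mass constraint_matrix_def lp_original_def Let_def)
  moreover have "lp_lhs (lp_original n P lam x xs) r v = (\<Sum>k\<in>?A. v (Y i j k))"
    by (simp add: Mass lp_original_def Let_def)
  ultimately show ?thesis by (simp only:)
qed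

lemma constraint_matrix_reduced:
  assumes "r \<in> lp_rows (lp_reduced n P lam x xs)"
  shows "lp_lhs (lp_reduced n P lam x xs) r v =
    (\<Sum>c\<in>lp_vars (lp_reduced n P lam x xs). constraint_matrix (lp_reduced n P lam x xs) r c * v c)"
proof (cases r)
  case (Link i k)
  let ?V = "lp_vars (lp_reduced n P lam x xs)"
  let ?A = "{j. (i, j) \<in> mean_pairs n P lam x xs k}"
  have "Z k \<in> ?V" "\<And>j. j \<in> ?A \<Longrightarrow> Y i j k \<in> ?V"
    using assms Link by (auto simp: lp_reduced_def Let_def bary_rows_def mean_pairs_def)
  then have
    "(\<Sum>c\<in>?V. (\<Sum>j\<in>?A. if Y i j k = c then 1 else 0) * v c) = (\<Sum>j\<in>?A. v (Y i j k))"
    "(\<Sum>c\<in>?V. (if Z k = c then 1 else 0) * v c) = v (Z k)"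
    by (auto intro!: sum_unit_assignment sum_unit_assignment_single finite_lp_vars)
  moreover have "constraint_matrix (lp_reduced n P lam x xs) r c =
      (\<Sum>j\<in>?A. if Y i j k = c then 1 else 0) - (if Z k = c then 1 else 0)" for c
    by (simp add: Link constraint_matrix_def lp_reduced_def Let_def)
  moreover have "lp_lhs (lp_reduced n P lam x xs) r v = (\<Sum>j\<in>?A. v (Y i j k)) - v (Z k)"
    by (simp add: Link lp_reduced_def Let_def)
  ultimately show ?thesis by (simp only: left_diff_distrib sum_subtractf)
next
  case (Mass i j)
  let ?V = "lp_vars (lp_reduced n P lam x xs)"
  let ?A = "mean_indices n P lam x xs i j"
  have "\<And>k. k \<in> ?A \<Longrightarrow> Y i j k \<in> ?V"
    using assms Mass by (auto simp: lp_reduced_def Let_def bary_rows_def)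
  then have "(\<Sum>c\<in>?V. (\<Sum>k\<in>?A. if Y i j k = c then 1 else 0) * v c) = (\<Sum>k\<in>?A. v (Y i j k))"
    by (auto intro!: sum_unit_assignment finite_lp_vars)
  moreover have "constraint_matrix (lp_reduced n P lam x xs) r c =
      (\<Sum>k\<in>?A. if Y i j k = c then 1 else 0)" for c
    by (simp add: Mass constraint_matrix_def lp_reduced_def Let_def)
  moreover have "lp_lhs (lp_reduced n P lam x xs) r v = (\<Sum>k\<in>?A. v (Y i j k))"
    by (simp add: Mass lp_reduced_def Let_def)
  ultimately show ?thesis by (simp only:)
qed

end

theory Submission
  imports Defs
begin

text \<open>
  Every column of the reduced program is also a column of the original one, with the same entries, so
  it suffices to find a pair \<open>(i, j)\<close> with \<open>S\<^sub>i\<^sub>j \<noteq> {1..card S}\<close>. If \<open>P i\<close> has two distinct support points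
  \<open>a\<close>, \<open>b\<close> and every weighted mean could be written with \<open>a\<close> in position \<open>i\<close>, then replacing \<open>a\<close> by
  \<open>b\<close> would show that \<open>S\<close> is mapped into itself by the translation along \<open>\<lambda>\<^sub>i (b - a)\<close>; this is
  impossible for a finite nonempty set and a nonzero vector.
\<close>

text \<open>Translation by \<open>v\<close> is injective, hence a permutation of the finite set
  \<open>S\<close>. Summing the elements of \<open>S\<close> before and after it gives
  \<open>card S\<close> times \<open>v\<close> equal to 0, and \<open>card S\<close> is
  positive.\<close>

lemma finite_translation_invariant_imp_zero:
  fixes v :: "'a::real_vector"
  assumes "finite S" "S \<noteq> {}" and invariant: "\<And>s. s \<in> S \<Longrightarrow> s + v \<in> S"
  shows "v = 0"
proof -
  have inj: "inj_on (\<lambda>s. s + v) S" by (simp add: inj_on_def)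
  have "(\<lambda>s. s + v) ` S = S"
    using assms inj by (intro endo_inj_surj) auto
  then have "(\<Sum>s\<in>S. s) = (\<Sum>s\<in>S. s + v)"
    using sum.reindex[OF inj, of "\<lambda>s. s"] by simp
  also have "\<dots> = (\<Sum>s\<in>S. s) + real (card S) *\<^sub>R v"
    by (simp add: sum.distrib sum_constant_scaleR)
  finally show ?thesis using assms by simp
qed

lemma finite_weighted_means: "finite (weighted_means n P lam x)"
proof -
  let ?f = "\<lambda>j. \<Sum>i\<in>{1..n}. lam i *\<^sub>R x i (j i)"
  have "weighted_means n P lam x \<subseteq> ?f ` (PiE {1..n} (\<lambda>i. {1..supp_size P i}))"
  proof
    fix s assume "s \<in> weighted_means n P lam x"
    then obtain j where j: "s = ?f j" "\<forall>i\<in>{1..n}. j i \<in> {1..supp_size P i}"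
      by (auto simp: weighted_means_def)
    then show "s \<in> ?f ` (PiE {1..n} (\<lambda>i. {1..supp_size P i}))"
      \<comment> \<open>\<open>PiE\<close> contains only functions that are \<open>undefined\<close>
        off \<open>{1..n}\<close>; restricting \<open>j\<close> achieves this and leaves the sum
        unchanged.\<close>
      by (intro image_eqI[of _ _ "restrict j {1..n}"]) auto
  qed
  then show ?thesis by (rule finite_subset) (simp add: finite_PiE)
qed

lemma weighted_means_nonempty:
  assumes "\<And>i. i \<in> {1..n} \<Longrightarrow> supp_size P i \<ge> 1"
  shows "weighted_means n P lam x \<noteq> {}"
proof -
  have "(\<Sum>i\<in>{1..n}. lam i *\<^sub>R x i 1) \<in> weighted_means n P lam x"
    unfolding weighted_means_def using assms by (intro CollectI exI[of _ "\<lambda>_. 1"]) auto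
  then show ?thesis by blast
qed

lemma mean_indices_subset: "mean_indices n P lam x xs i j \<subseteq> {1..card (weighted_means n P lam x)}"
  by (auto simp: mean_indices_def)

lemma weighted_mean_replace:
  assumes i: "i \<in> {1..n}" and j': "j' \<in> {1..supp_size P i}"
    and k: "k \<in> mean_indices n P lam x xs i j"
  shows "xs k + lam i *\<^sub>R (x i j' - x i j) \<in> weighted_means n P lam x"
proof -
  from k obtain m where m: "\<forall>l\<in>{1..n} - {i}. m l \<in> {1..supp_size P l}"
    and xk: "xs k = lam i *\<^sub>R x i j + (\<Sum>l\<in>{1..n} - {i}. lam l *\<^sub>R x l (m l))"
    by (auto simp: mean_indices_def)
  \<comment> \<open>The choice \<open>m\<close> says nothing about position \<open>i\<close>, so
    setting it to \<open>j'\<close> there yields an admissible choice for all positions.\<close>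
  have "(\<Sum>l\<in>{1..n}. lam l *\<^sub>R x l ((m(i := j')) l))
      = lam i *\<^sub>R x i j' + (\<Sum>l\<in>{1..n} - {i}. lam l *\<^sub>R x l ((m(i := j')) l))"
    using i by (subst sum.remove[of _ i]) auto
  also have "(\<Sum>l\<in>{1..n} - {i}. lam l *\<^sub>R x l ((m(i := j')) l))
      = (\<Sum>l\<in>{1..n} - {i}. lam l *\<^sub>R x l (m l))"
    by (rule sum.cong) auto
  finally have "xs k + lam i *\<^sub>R (x i j' - x i j) = (\<Sum>l\<in>{1..n}. lam l *\<^sub>R x l ((m(i := j')) l))"
    by (simp add: xk algebra_simps)
  moreover have "\<forall>l\<in>{1..n}. (m(i := j')) l \<in> {1..supp_size P l}" using m j' by auto
  ultimately show ?thesis unfolding weighted_means_def by blast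
qed

lemma mean_indices_strict_subset:
  assumes i: "i \<in> {1..n}" and j': "j' \<in> {1..supp_size P i}"
    and neq: "x i j \<noteq> x i j'" and lam: "lam i \<noteq> 0"
    and onto: "xs ` {1..card (weighted_means n P lam x)} = weighted_means n P lam x"
    and nonempty: "weighted_means n P lam x \<noteq> {}"
  shows "mean_indices n P lam x xs i j \<subset> {1..card (weighted_means n P lam x)}"
proof (rule psubsetI[OF mean_indices_subset], rule notI)
  assume all: "mean_indices n P lam x xs i j = {1..card (weighted_means n P lam x)}"
  have "lam i *\<^sub>R (x i j' - x i j) = 0"
  proof (rule finite_translation_invariant_imp_zero[OF finite_weighted_means nonempty])
    fix s assume "s \<in> weighted_means n P lam x"
    then obtain k where "k \<in> mean_indices n P lam x xs i j" "s = xs k"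
      using onto all by blast
    then show "s + lam i *\<^sub>R (x i j' - x i j) \<in> weighted_means n P lam x"
      using weighted_mean_replace[OF i j'] by blast
  qed
  then show False using neq lam by simp
qed

lemma lp_rows_reduced: "lp_rows (lp_reduced n P lam x xs) = lp_rows (lp_original n P lam x xs)"
  by (simp add: lp_reduced_def lp_original_def Let_def)

lemma lp_vars_reduced_subset: "lp_vars (lp_reduced n P lam x xs) \<subseteq> lp_vars (lp_original n P lam x xs)"
  using mean_indices_subset[of n P lam x xs]
  unfolding lp_reduced_def lp_original_def Let_def lin_prog.simps by blast

lemma Y_in_lp_vars_original:
  "Y i j k \<in> lp_vars (lp_original n P lam x xs) \<longleftrightarrow>
     i \<in> {1..n} \<and> j \<in> {1..supp_size P i} \<and> k \<in> {1..card (weighted_means n P lam x)}"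
  by (auto simp: lp_original_def Let_def)

lemma Y_in_lp_vars_reduced:
  "Y i j k \<in> lp_vars (lp_reduced n P lam x xs) \<longleftrightarrow>
     i \<in> {1..n} \<and> j \<in> {1..supp_size P i} \<and> k \<in> mean_indices n P lam x xs i j"
  by (auto simp: lp_reduced_def Let_def)

text \<open>The original row has extra summands only for names \<open>Y i j k\<close> with
  \<open>k\<close> outside \<open>mean_indices n P lam x xs i j\<close>. Such a name is not a
  reduced variable, so it differs from \<open>c\<close> and the summand is 0 at the unit assignment
  of \<open>c\<close>.\<close>

lemma constraint_matrix_reduced_eq_original:
  assumes c: "c \<in> lp_vars (lp_reduced n P lam x xs)"
    and r: "r \<in> lp_rows (lp_reduced n P lam x xs)"
  shows "constraint_matrix (lp_reduced n P lam x xs) r c =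
         constraint_matrix (lp_original n P lam x xs) r c"
proof (cases r)
  case (Link i k)
  have "(\<Sum>j | (i, j) \<in> mean_pairs n P lam x xs k. if Y i j k = c then 1 else 0 :: real)
      = (\<Sum>j\<in>{1..supp_size P i}. if Y i j k = c then 1 else 0)"
    using c by (intro sum.mono_neutral_left)
      (auto simp: mean_pairs_def Y_in_lp_vars_reduced)
  then show ?thesis
    by (simp add: Link constraint_matrix_def lp_reduced_def lp_original_def Let_def)
next
  case (Mass i j)
  have "(\<Sum>k\<in>mean_indices n P lam x xs i j. if Y i j k = c then 1 else 0 :: real)
      = (\<Sum>k\<in>{1..card (weighted_means n P lam x)}. if Y i j k = c then 1 else 0)"
    using c mean_indices_subset[of n P lam x xs i j] by (intro sum.mono_neutral_left)
      (auto simp: Y_in_lp_vars_reduced)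
  then show ?thesis
    by (simp add: Mass constraint_matrix_def lp_reduced_def lp_original_def Let_def)
qed

lemma nonzero_entries_reduced_subset:
  "nonzero_entries (lp_reduced n P lam x xs) \<subseteq> nonzero_entries (lp_original n P lam x xs)"
  using lp_vars_reduced_subset[of n P lam x xs]
  by (auto simp: nonzero_entries_def lp_rows_reduced constraint_matrix_reduced_eq_original)

text \<open>Every \<open>Y\<close> column has a nonzero entry in its \<open>Mass\<close> row, so
  dropping even one such column loses a nonzero entry.\<close>

lemma mass_entry_original:
  assumes "Y i j k \<in> lp_vars (lp_original n P lam x xs)"
  shows "(Mass i j, Y i j k, 1) \<in> nonzero_entries (lp_original n P lam x xs)"
  using assms
  \<comment> \<open>Membership in the variable set is settled first, while
    \<open>lp_original\<close> is still folded.\<close>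
  by (simp add: nonzero_entries_def Y_in_lp_vars_original)
    (simp add: constraint_matrix_def lp_original_def Let_def bary_rows_def)

theorem lemma1:
  fixes n :: nat
    and P :: "nat \<Rightarrow> (real^'d) pmf"
    and lam :: "nat \<Rightarrow> real"
    and x :: "nat \<Rightarrow> nat \<Rightarrow> real^'d"
    and xs :: "nat \<Rightarrow> real^'d"
  assumes finite_support: "\<And>i. i \<in> {1..n} \<Longrightarrow> finite (set_pmf (P i))"
    and support_enum: "\<And>i. i \<in> {1..n} \<Longrightarrow> bij_betw (x i) {1..supp_size P i} (set_pmf (P i))"
    and nontrivial: "\<exists>i\<in>{1..n}. supp_size P i \<ge> 2"
    and lam_pos: "\<And>i. i \<in> {1..n} \<Longrightarrow> lam i > 0"
    and lam_sum: "(\<Sum>i\<in>{1..n}. lam i) = 1"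
    and means_enum:
      "bij_betw xs {1..card (weighted_means n P lam x)} (weighted_means n P lam x)"
  shows "card (lp_vars (lp_reduced n P lam x xs)) < card (lp_vars (lp_original n P lam x xs)) \<and>
         nonzero_entries (lp_reduced n P lam x xs) \<subset> nonzero_entries (lp_original n P lam x xs)"
proof -
  let ?S = "weighted_means n P lam x"
  let ?R = "lp_reduced n P lam x xs" and ?O = "lp_original n P lam x xs"
  obtain i where i: "i \<in> {1..n}" "supp_size P i \<ge> 2" using nontrivial by blast
  \<comment> \<open>Finiteness matters here, since \<open>card\<close> is 0 on infinite
    sets.\<close>
  have "supp_size P l \<ge> 1" if "l \<in> {1..n}" for l
    using finite_support[OF that] set_pmf_not_empty[of "P l"]
    by (simp add: supp_size_def Suc_le_eq card_gt_0_iff)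
  then have nonempty: "?S \<noteq> {}" by (rule weighted_means_nonempty)
  have range: "1 \<in> {1..supp_size P i}" "2 \<in> {1..supp_size P i}" using i by auto
  then have "x i 1 \<noteq> x i 2"
    using bij_betw_imp_inj_on[OF support_enum[OF i(1)]] by (auto dest: inj_onD)
  then have "mean_indices n P lam x xs i 1 \<subset> {1..card ?S}"
    using i(1) range(2) lam_pos[OF i(1)] nonempty bij_betw_imp_surj_on[OF means_enum]
    by (intro mean_indices_strict_subset[where j' = 2]) auto
  \<comment> \<open>The single missing variable \<open>Y i 1 k\<close> witnesses both strict
    inclusions: of the variables, and of the nonzero entries through row
    \<open>Mass i 1\<close>.\<close>
  then obtain k where k: "k \<in> {1..card ?S}" "k \<notin> mean_indices n P lam x xs i 1" by blast
  have in_O: "Y i 1 k \<in> lp_vars ?O" using i(1) range(1) k(1) by (simp add: Y_in_lp_vars_original)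
  have notin_R: "Y i 1 k \<notin> lp_vars ?R" using k(2) by (simp add: Y_in_lp_vars_reduced)
  have "lp_vars ?R \<subset> lp_vars ?O" using lp_vars_reduced_subset in_O notin_R by blast
  then have "card (lp_vars ?R) < card (lp_vars ?O)" by (rule psubset_card_mono[OF finite_lp_vars(1)])
  moreover have "(Mass i 1, Y i 1 k, 1) \<notin> nonzero_entries ?R"
    using notin_R by (simp add: nonzero_entries_def)
  ultimately show ?thesis
    using nonzero_entries_reduced_subset mass_entry_original[OF in_O] by blast
qed

end
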